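(* Let $p \in [1, \infty) \setminus \{ 2 \}$. Let $X$ be a compact metrizable space, let $(Y, \mathcal{C}, \nu)$ be a $\sigma$-finite measure space, and let $\pi \colon C (X) \to L(L^p(Y,\nu))$ be a contractive unital homomorphism. Let $\mu \colon L^{\infty} (Y, \nu) \to L(L^p(Y,\nu))$ be the representation of $L^{\infty} (Y, \nu)$ on $L^p (Y, \nu)$ by multiplication operators. Then there exists a unital C*-algebra homomorphism (unital $*$-homomorphism) $\varphi \colon C (X) \to L^{\infty} (Y, \nu)$ such that $\pi = \mu \circ \varphi$.
   Context: All algebras and function spaces are over $\mathbb{C}$. $C(X)$ is the algebra of continuous complex functions on $X$ with the supremum norm. $L(E)$ is the Banach algebra of bounded linear operators on a Banach space $E$ with the operator norm. *)

theory Defs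
  imports "HOL-Analysis.Analysis" "HOL-Algebra.Module"
begin

section \<open>Normed spaces and algebras over the complex numbers with explicit carriers\<close>

text \<open>
  The spaces \<open>L\<^sup>p(Y,\<nu>)\<close> and \<open>L\<^sup>\<infinity>(Y,\<nu>)\<close> depend on a measure and \<open>C(X)\<close> on a topology,
  so they cannot be types.  They are given as HOL-Algebra module records with scalars in
  \<^typ>\<open>complex\<close>, extended by a norm and, for C*-algebras, by an involution.
\<close>

record 'a normed_module = "(complex, 'a) module" +
  mnorm :: "'a \<Rightarrow> real"

record 'a star_algebra = "'a normed_module" +
  star :: "'a \<Rightarrow> 'a"

definition unital_algebra_hom ::
  "('a, 'm) normed_module_scheme \<Rightarrow> ('b, 'n) normed_module_scheme \<Rightarrow> ('a \<Rightarrow> 'b) \<Rightarrow> bool" where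
  "unital_algebra_hom A B h \<longleftrightarrow>
     h \<in> ring_hom A B \<and>
     (\<forall>c. \<forall>a\<in>carrier A. h (c \<odot>\<^bsub>A\<^esub> a) = c \<odot>\<^bsub>B\<^esub> h a)"

definition unital_star_hom ::
  "('a, 'm) star_algebra_scheme \<Rightarrow> ('b, 'n) star_algebra_scheme \<Rightarrow> ('a \<Rightarrow> 'b) \<Rightarrow> bool" where
  "unital_star_hom A B h \<longleftrightarrow>
     unital_algebra_hom A B h \<and>
     (\<forall>a\<in>carrier A. h (star A a) = star B (h a))"

definition contractive ::
  "('a, 'm) normed_module_scheme \<Rightarrow> ('b, 'n) normed_module_scheme \<Rightarrow> ('a \<Rightarrow> 'b) \<Rightarrow> bool" where
  "contractive A B h \<longleftrightarrow> (\<forall>a\<in>carrier A. mnorm B (h a) \<le> mnorm A a)"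

text \<open>
  The algebra \<open>L(E)\<close>.  Operators are extensional functions on the carrier of \<open>E\<close>, so that
  equality of operators is equality of HOL functions.  The fields \<^const>\<open>mult\<close> and \<^const>\<open>one\<close>
  of \<open>E\<close> are not used.
\<close>

definition bounded_operators ::
  "('e, 'm) normed_module_scheme \<Rightarrow> ('e \<Rightarrow> 'e) normed_module" where
  "bounded_operators E =
    \<lparr>carrier = {T \<in> carrier E \<rightarrow>\<^sub>E carrier E.
        (\<forall>x\<in>carrier E. \<forall>y\<in>carrier E. T (x \<oplus>\<^bsub>E\<^esub> y) = T x \<oplus>\<^bsub>E\<^esub> T y) \<and>
        (\<forall>c. \<forall>x\<in>carrier E. T (c \<odot>\<^bsub>E\<^esub> x) = c \<odot>\<^bsub>E\<^esub> T x) \<and>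
        (\<exists>K. \<forall>x\<in>carrier E. mnorm E (T x) \<le> K * mnorm E x)},
     mult = compose (carrier E),
     one = (\<lambda>x\<in>carrier E. x),
     zero = (\<lambda>x\<in>carrier E. \<zero>\<^bsub>E\<^esub>),
     add = (\<lambda>S T. \<lambda>x\<in>carrier E. S x \<oplus>\<^bsub>E\<^esub> T x),
     smult = (\<lambda>c T. \<lambda>x\<in>carrier E. c \<odot>\<^bsub>E\<^esub> T x),
     mnorm = (\<lambda>T. SUP x\<in>{x\<in>carrier E. mnorm E x \<le> 1}. mnorm E (T x))\<rparr>"


section \<open>The C*-algebra of continuous functions\<close>

text \<open>
  The \<open>insert 0\<close> gives the norm its correct value when \<open>X\<close> is empty; otherwise it has no effect.
\<close>

definition C_algebra :: "'x topology \<Rightarrow> ('x \<Rightarrow> complex) star_algebra" where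
  "C_algebra X =
    \<lparr>carrier = {f \<in> extensional (topspace X). continuous_map X euclidean f},
     mult = (\<lambda>f g. \<lambda>x\<in>topspace X. f x * g x),
     one = (\<lambda>x\<in>topspace X. 1),
     zero = (\<lambda>x\<in>topspace X. 0),
     add = (\<lambda>f g. \<lambda>x\<in>topspace X. f x + g x),
     smult = (\<lambda>c f. \<lambda>x\<in>topspace X. c * f x),
     mnorm = (\<lambda>f. Sup (insert 0 ((\<lambda>x. cmod (f x)) ` topspace X))),
     star = (\<lambda>f. \<lambda>x\<in>topspace X. cnj (f x))\<rparr>"


section \<open>Spaces of classes of measurable functions modulo equality almost everywhere\<close>

definition ae_class :: "'y measure \<Rightarrow> ('y \<Rightarrow> complex) \<Rightarrow> ('y \<Rightarrow> complex) set" where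
  "ae_class M f = {g \<in> borel_measurable M. AE y in M. g y = f y}"

definition rep :: "('y \<Rightarrow> complex) set \<Rightarrow> 'y \<Rightarrow> complex" where
  "rep F = (SOME f. f \<in> F)"

lemma ae_class_eq_iff:
  assumes "f \<in> borel_measurable M"
  shows "ae_class M f = ae_class M g \<longleftrightarrow> (AE y in M. f y = g y)"
proof
  assume "ae_class M f = ae_class M g"
  moreover have "f \<in> ae_class M f" using assms by (simp add: ae_class_def)
  ultimately show "AE y in M. f y = g y" by (simp add: ae_class_def)
next
  assume *: "AE y in M. f y = g y"
  show "ae_class M f = ae_class M g"
    unfolding ae_class_def
  proof (intro Collect_cong conj_cong refl iffI)
    fix h
    show "AE y in M. h y = g y" if "AE y in M. h y = f y" using that * by eventually_elim simp
    show "AE y in M. h y = f y" if "AE y in M. h y = g y" using that * by eventually_elim simp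
  qed
qed

lemma rep_ae_class:
  assumes "f \<in> borel_measurable M"
  shows "rep (ae_class M f) \<in> borel_measurable M" "AE y in M. rep (ae_class M f) y = f y"
proof -
  have "f \<in> ae_class M f" using assms by (simp add: ae_class_def)
  then have "rep (ae_class M f) \<in> ae_class M f" unfolding rep_def
    by (rule someI[of "\<lambda>g. g \<in> ae_class M f"])
  then show "rep (ae_class M f) \<in> borel_measurable M" "AE y in M. rep (ae_class M f) y = f y"
    by (simp_all add: ae_class_def)
qed

text \<open>
  All operations below are defined through representatives; by the two preceding lemmas they
  do not depend on the choice made by \<^const>\<open>rep\<close>.
\<close>

definition Lp_space :: "real \<Rightarrow> 'y measure \<Rightarrow> ('y \<Rightarrow> complex) set normed_module" where
  "Lp_space p M =
    \<lparr>carrier = ae_class M `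
        {f \<in> borel_measurable M. integrable M (\<lambda>y. cmod (f y) powr p)},
     mult = undefined,
     one = undefined,
     zero = ae_class M (\<lambda>y. 0),
     add = (\<lambda>F G. ae_class M (\<lambda>y. rep F y + rep G y)),
     smult = (\<lambda>c F. ae_class M (\<lambda>y. c * rep F y)),
     mnorm = (\<lambda>F. (\<integral>y. cmod (rep F y) powr p \<partial>M) powr (1 / p))\<rparr>"

definition Linfty_algebra :: "'y measure \<Rightarrow> ('y \<Rightarrow> complex) set star_algebra" where
  "Linfty_algebra M =
    \<lparr>carrier = ae_class M `
        {f \<in> borel_measurable M. \<exists>K. AE y in M. cmod (f y) \<le> K},
     mult = (\<lambda>F G. ae_class M (\<lambda>y. rep F y * rep G y)),
     one = ae_class M (\<lambda>y. 1),
     zero = ae_class M (\<lambda>y. 0),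
     add = (\<lambda>F G. ae_class M (\<lambda>y. rep F y + rep G y)),
     smult = (\<lambda>c F. ae_class M (\<lambda>y. c * rep F y)),
     mnorm = (\<lambda>F. Inf {K. 0 \<le> K \<and> (AE y in M. cmod (rep F y) \<le> K)}),
     star = (\<lambda>F. ae_class M (\<lambda>y. cnj (rep F y)))\<rparr>"

definition mult_rep ::
  "real \<Rightarrow> 'y measure \<Rightarrow> ('y \<Rightarrow> complex) set \<Rightarrow>
     ('y \<Rightarrow> complex) set \<Rightarrow> ('y \<Rightarrow> complex) set" where
  "mult_rep p M H = (\<lambda>F\<in>carrier (Lp_space p M). ae_class M (\<lambda>y. rep H y * rep F y))"

end

theory Submission
  imports Defs
begin

text \<open>
  The operators \<open>\<pi>(u)\<close> with \<open>|u| = 1\<close> are isometries, because \<open>\<pi>(u)\<close> and its inverse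
  \<open>\<pi>(cnj u)\<close> are both contractions.  For \<open>p \<noteq> 2\<close>, two functions \<open>\<xi>, \<eta>\<close> in \<open>L\<^sup>p\<close> satisfy
  \<open>\<xi> \<eta> = 0\<close> almost everywhere exactly when equality holds in Clarkson's inequality for them
  (lemma \<open>disjoint_iff_clarkson_equality\<close>).  The equality involves only the norms of
  \<open>\<xi>\<close>, \<open>\<eta>\<close>, \<open>\<xi> + \<eta>\<close> and \<open>\<xi> - \<eta>\<close>, so linear isometries preserve disjointness.  This is the
  elementary half of Lamperti's theorem; its description of all isometries is avoided as follows.

  Let \<open>g\<close> be real and continuous on \<open>X\<close> and \<open>\<xi> \<eta> = 0\<close>.  Then
  \<open>\<pi>(exp(i t g))\<xi> \<cdot> \<pi>(exp(i t g))\<eta> = 0\<close> for all \<open>t\<close>, and the coefficient of \<open>t\<close> at \<open>t = 0\<close>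
  is a multiple of \<open>\<xi> \<cdot> \<pi>(g)\<eta> + \<pi>(g)\<xi> \<cdot> \<eta>\<close>.  The two summands live on disjoint sets, so
  \<open>\<xi> \<cdot> \<pi>(g)\<eta> = 0\<close>: the operator \<open>\<pi>(g)\<close>, and hence \<open>\<pi>(f)\<close> for every \<open>f\<close> in \<open>C(X)\<close>, does not
  enlarge supports (lemmas \<open>act_real_local\<close> and \<open>act_local\<close>).

  An operator of norm at most \<open>K\<close> that does not enlarge supports commutes with restriction to
  measurable sets, so its norm bound holds on every set and becomes the pointwise bound
  \<open>|\<pi>(f)\<xi>| \<le> K |\<xi>|\<close> (lemma \<open>act_pointwise_le\<close>).  Fix \<open>w\<close> in \<open>L\<^sup>p\<close> without zeros, which exists by
  \<open>\<sigma>\<close>-finiteness.  The pointwise bound for \<open>\<xi> - c w\<close>, with \<open>c\<close> in a countable dense set of scalars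
  and then \<open>c\<close> tending to \<open>\<xi>(y)/w(y)\<close>, shows that \<open>\<pi>(f)\<close> is multiplication by
  \<open>\<pi>(f)w / w\<close> (lemma \<open>act_eq_symbol_mult\<close>), and this quotient is \<open>\<phi>(f)\<close>.

  That \<open>\<phi>\<close> is a unital homomorphism follows by evaluating at \<open>w\<close>.  It preserves the involution
  because it maps real functions to real functions: for real \<open>f\<close> bounded by \<open>K\<close> and \<open>h = \<phi>(f)\<close>,
  \<open>|h + i c|\<^sup>2 \<le> K\<^sup>2 + c\<^sup>2\<close> for all integers \<open>c\<close>, which forces \<open>Im h = 0\<close>
  (lemma \<open>symbol_real\<close>).
\<close>

section \<open>The case of equality in Clarkson's inequality\<close>

lemma powr_superadditive_strict:
  fixes a b s :: real
  assumes "0 < a" "0 < b" "1 < s"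
  shows "a powr s + b powr s < (a + b) powr s"
proof -
  have split: "c powr s = c * c powr (s - 1)" if "0 < c" for c :: real
    using that powr_add[of c 1 "s - 1"] by simp
  have "a * a powr (s - 1) + b * b powr (s - 1) < a * (a + b) powr (s - 1) + b * (a + b) powr (s - 1)"
    using assms by (intro add_strict_mono mult_strict_left_mono powr_less_mono2) auto
  then show ?thesis
    using assms by (simp add: split distrib_right)
qed

text \<open>
  For an exponent below one, apply the case of the exponent \<open>1/s > 1\<close> to \<open>a\<^sup>s\<close> and \<open>b\<^sup>s\<close>.
\<close>
lemma powr_subadditive_strict:
  fixes a b s :: real
  assumes "0 < a" "0 < b" "0 < s" "s < 1"
  shows "(a + b) powr s < a powr s + b powr s"
proof -
  have "(a powr s) powr (1/s) + (b powr s) powr (1/s) < (a powr s + b powr s) powr (1/s)"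
    using assms by (intro powr_superadditive_strict) auto
  then have "a + b < (a powr s + b powr s) powr (1/s)"
    using assms by (simp add: powr_powr)
  then have "(a + b) powr s < ((a powr s + b powr s) powr (1/s)) powr s"
    using assms by (intro powr_less_mono2) auto
  then show ?thesis
    using assms by (simp add: powr_powr)
qed

text \<open>
  For positive arguments this is midpoint convexity; an argument equal to zero
  amounts to \<open>2 \<le> 2\<^sup>s\<close>.
\<close>
lemma powr_mean_le:
  fixes u v s :: real
  assumes "0 \<le> u" "0 \<le> v" "1 \<le> s"
  shows "2 * ((u + v) / 2) powr s \<le> u powr s + v powr s"
proof -
  have half: "2 * (c / 2) powr s \<le> c powr s" if "0 \<le> c" for c :: real
  proof -
    have "(2::real) powr 1 \<le> 2 powr s" using assms by (intro powr_mono) auto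
    then have "c powr s * 2 \<le> c powr s * 2 powr s"
      by (intro mult_left_mono) auto
    then show ?thesis using that by (simp add: powr_divide divide_simps mult.commute)
  qed
  show ?thesis
  proof (cases "u = 0 \<or> v = 0")
    case True
    then show ?thesis using half[of u] half[of v] assms by auto
  next
    case False
    then have pos: "0 < u" "0 < v" using assms by auto
    have "((1 - 1/2) *\<^sub>R u + (1/2) *\<^sub>R v) powr s \<le> (1 - 1/2) * u powr s + (1/2) * v powr s"
      using pos by (intro convex_onD[OF powr_convex[OF assms(3)]]) auto
    then show ?thesis by (simp add: field_simps)
  qed
qed

lemma powr_mean_ge:
  fixes u v s :: real
  assumes "0 \<le> u" "0 \<le> v" "0 < s" "s \<le> 1"
  shows "u powr s + v powr s \<le> 2 * ((u + v) / 2) powr s"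
proof -
  have "2 * ((u powr s + v powr s) / 2) powr (1/s) \<le> (u powr s) powr (1/s) + (v powr s) powr (1/s)"
    using assms by (intro powr_mean_le) auto
  then have "((u powr s + v powr s) / 2) powr (1/s) \<le> (u + v) / 2"
    using assms by (simp add: powr_powr)
  then have "(((u powr s + v powr s) / 2) powr (1/s)) powr s \<le> ((u + v) / 2) powr s"
    using assms by (intro powr_mono2) auto
  then show ?thesis
    using assms by (simp add: powr_powr)
qed

lemma cmod_powr_eq_square_powr: "cmod z powr p = ((cmod z)\<^sup>2) powr (p / 2)"
proof (cases "z = 0")
  case False
  then have "(cmod z)\<^sup>2 = cmod z powr 2" by simp
  then have "((cmod z)\<^sup>2) powr (p / 2) = cmod z powr (2 * (p / 2))" by (simp only: powr_powr)
  then show ?thesis by simp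
qed simp

lemma cmod_parallelogram: "((cmod (a + b))\<^sup>2 + (cmod (a - b))\<^sup>2) / 2 = (cmod a)\<^sup>2 + (cmod b)\<^sup>2"
  unfolding cmod_power2 by (simp add: power2_eq_square algebra_simps)

text \<open>
  The difference of the two sides of Clarkson's inequality.  Its sign depends on whether \<open>p\<close> is
  above or below \<open>2\<close>, but for positive \<open>p \<noteq> 2\<close> it vanishes only at pairs with product zero.
\<close>
definition clarkson_defect :: "real \<Rightarrow> complex \<Rightarrow> complex \<Rightarrow> real" where
  "clarkson_defect p a b =
     cmod (a + b) powr p + cmod (a - b) powr p - 2 * (cmod a powr p + cmod b powr p)"

lemma clarkson_defect_zero: "a * b = 0 \<Longrightarrow> clarkson_defect p a b = 0"
  by (auto simp: clarkson_defect_def)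

text \<open>
  With \<open>A = |a|\<^sup>2\<close>, \<open>B = |b|\<^sup>2\<close>, \<open>s = p/2 > 1\<close>, the parallelogram law says that
  \<open>|a + b|\<^sup>2\<close> and \<open>|a - b|\<^sup>2\<close> have mean \<open>A + B\<close>.  By convexity the sum of their \<open>s\<close>-th powers is at
  least \<open>2 (A + B)\<^sup>s\<close>, which exceeds \<open>2 (A\<^sup>s + B\<^sup>s)\<close> when neither vanishes.  For \<open>s < 1\<close> both
  inequalities are reversed, which is the next lemma.
\<close>
lemma clarkson_defect_pos:
  assumes "2 < p" "a * b \<noteq> 0"
  shows "0 < clarkson_defect p a b"
proof -
  let ?s = "p / 2"
  have "2 * (cmod a powr p + cmod b powr p) < 2 * ((cmod a)\<^sup>2 + (cmod b)\<^sup>2) powr ?s"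
    using powr_superadditive_strict[of "(cmod a)\<^sup>2" "(cmod b)\<^sup>2" ?s] assms
    by (simp add: cmod_powr_eq_square_powr)
  also have "\<dots> = 2 * (((cmod (a + b))\<^sup>2 + (cmod (a - b))\<^sup>2) / 2) powr ?s"
    by (simp only: cmod_parallelogram)
  also have "\<dots> \<le> cmod (a + b) powr p + cmod (a - b) powr p"
    using powr_mean_le[of "(cmod (a + b))\<^sup>2" "(cmod (a - b))\<^sup>2" ?s] assms
    by (simp add: cmod_powr_eq_square_powr)
  finally show ?thesis by (simp add: clarkson_defect_def)
qed

lemma clarkson_defect_neg:
  assumes "0 < p" "p < 2" "a * b \<noteq> 0"
  shows "clarkson_defect p a b < 0"
proof -
  let ?s = "p / 2"
  have "cmod (a + b) powr p + cmod (a - b) powr p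
      \<le> 2 * (((cmod (a + b))\<^sup>2 + (cmod (a - b))\<^sup>2) / 2) powr ?s"
    using powr_mean_ge[of "(cmod (a + b))\<^sup>2" "(cmod (a - b))\<^sup>2" ?s] assms
    by (simp add: cmod_powr_eq_square_powr)
  also have "\<dots> = 2 * ((cmod a)\<^sup>2 + (cmod b)\<^sup>2) powr ?s"
    by (simp only: cmod_parallelogram)
  also have "\<dots> < 2 * (cmod a powr p + cmod b powr p)"
    using powr_subadditive_strict[of "(cmod a)\<^sup>2" "(cmod b)\<^sup>2" ?s] assms
    by (simp add: cmod_powr_eq_square_powr)
  finally show ?thesis by (simp add: clarkson_defect_def)
qed

section \<open>Functions with integrable \<open>p\<close>-th power\<close>

definition Lp_functions :: "real \<Rightarrow> 'y measure \<Rightarrow> ('y \<Rightarrow> complex) set" where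
  "Lp_functions p M = {f \<in> borel_measurable M. integrable M (\<lambda>y. cmod (f y) powr p)}"

lemma Lp_functions_measurable [measurable_dest]: "\<xi> \<in> Lp_functions p M \<Longrightarrow> \<xi> \<in> borel_measurable M"
  by (simp add: Lp_functions_def)

lemma Lp_functions_integrable: "\<xi> \<in> Lp_functions p M \<Longrightarrow> integrable M (\<lambda>y. cmod (\<xi> y) powr p)"
  by (simp add: Lp_functions_def)

lemma Lp_functions_dominated:
  assumes "\<xi> \<in> Lp_functions p M" "\<eta> \<in> borel_measurable M" "0 \<le> p"
    and "AE y in M. cmod (\<eta> y) \<le> cmod (\<xi> y)"
  shows "\<eta> \<in> Lp_functions p M"
proof -
  have "integrable M (\<lambda>y. cmod (\<eta> y) powr p)"
  proof (rule Bochner_Integration.integrable_bound[OF Lp_functions_integrable[OF assms(1)]])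
    show "AE y in M. norm (cmod (\<eta> y) powr p) \<le> norm (cmod (\<xi> y) powr p)"
      using assms(4) by eventually_elim (use assms(3) in \<open>auto intro: powr_mono2\<close>)
  qed (use assms(2) in measurable)
  then show ?thesis using assms(2) by (simp add: Lp_functions_def)
qed

lemma Lp_functions_cong_AE:
  assumes "\<xi> \<in> Lp_functions p M" "\<eta> \<in> borel_measurable M" "0 \<le> p" "AE y in M. \<eta> y = \<xi> y"
  shows "\<eta> \<in> Lp_functions p M"
  by (rule Lp_functions_dominated[OF assms(1-3)]) (use assms(4) in eventually_elim, simp)

lemma Lp_functions_cmult:
  assumes "\<xi> \<in> Lp_functions p M"
  shows "(\<lambda>y. c * \<xi> y) \<in> Lp_functions p M"
  using assms by (auto simp: Lp_functions_def norm_mult powr_mult)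

lemma Lp_functions_add:
  assumes "\<xi> \<in> Lp_functions p M" "\<eta> \<in> Lp_functions p M" "0 \<le> p"
  shows "(\<lambda>y. \<xi> y + \<eta> y) \<in> Lp_functions p M"
proof -
  note [measurable] = Lp_functions_measurable[OF assms(1)] Lp_functions_measurable[OF assms(2)]
  have "integrable M (\<lambda>y. cmod (\<xi> y + \<eta> y) powr p)"
  proof (rule Bochner_Integration.integrable_bound)
    show "integrable M (\<lambda>y. 2 powr p * (cmod (\<xi> y) powr p + cmod (\<eta> y) powr p))"
      using assms(1,2) by (auto simp: Lp_functions_def)
    have "cmod (a + b) powr p \<le> 2 powr p * (cmod a powr p + cmod b powr p)" for a b
    proof -
      have "cmod (a + b) \<le> 2 * max (cmod a) (cmod b)"
        using norm_triangle_ineq[of a b] by linarith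
      then have "cmod (a + b) powr p \<le> (2 * max (cmod a) (cmod b)) powr p"
        using assms(3) by (intro powr_mono2) auto
      also have "\<dots> = 2 powr p * max (cmod a) (cmod b) powr p"
        by (simp add: powr_mult)
      also have "\<dots> \<le> 2 powr p * (cmod a powr p + cmod b powr p)"
        by (intro mult_left_mono) (auto simp: max_def)
      finally show ?thesis .
    qed
    then show "AE y in M. norm (cmod (\<xi> y + \<eta> y) powr p)
        \<le> norm (2 powr p * (cmod (\<xi> y) powr p + cmod (\<eta> y) powr p))"
      by auto
  qed measurable
  then show ?thesis by (simp add: Lp_functions_def)
qed

lemma Lp_functions_diff:
  assumes "\<xi> \<in> Lp_functions p M" "\<eta> \<in> Lp_functions p M" "0 \<le> p"
  shows "(\<lambda>y. \<xi> y - \<eta> y) \<in> Lp_functions p M"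
  using Lp_functions_add[OF assms(1) Lp_functions_cmult[OF assms(2), of "-1"] assms(3)] by simp

text \<open>
  The defect has constant sign, so its integral vanishes only if it vanishes almost everywhere.
\<close>
lemma disjoint_iff_clarkson_equality:
  assumes "0 < p" "p \<noteq> 2" and \<xi>: "\<xi> \<in> Lp_functions p M" and \<eta>: "\<eta> \<in> Lp_functions p M"
  shows "(AE y in M. \<xi> y * \<eta> y = 0) \<longleftrightarrow>
    (\<integral>y. cmod (\<xi> y + \<eta> y) powr p \<partial>M) + (\<integral>y. cmod (\<xi> y - \<eta> y) powr p \<partial>M)
      = 2 * ((\<integral>y. cmod (\<xi> y) powr p \<partial>M) + (\<integral>y. cmod (\<eta> y) powr p \<partial>M))"
proof -
  let ?D = "\<lambda>y. clarkson_defect p (\<xi> y) (\<eta> y)"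
  note int = Lp_functions_integrable[OF \<xi>] Lp_functions_integrable[OF \<eta>]
    Lp_functions_integrable[OF Lp_functions_add[OF \<xi> \<eta>]]
    Lp_functions_integrable[OF Lp_functions_diff[OF \<xi> \<eta>]]
  have int_D: "integrable M ?D"
    unfolding clarkson_defect_def using int assms(1) by auto
  have eq: "integral\<^sup>L M ?D = (\<integral>y. cmod (\<xi> y + \<eta> y) powr p \<partial>M) + (\<integral>y. cmod (\<xi> y - \<eta> y) powr p \<partial>M)
      - 2 * ((\<integral>y. cmod (\<xi> y) powr p \<partial>M) + (\<integral>y. cmod (\<eta> y) powr p \<partial>M))"
    unfolding clarkson_defect_def using int assms(1) by simp
  have "integral\<^sup>L M ?D = 0 \<longleftrightarrow> (AE y in M. \<xi> y * \<eta> y = 0)"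
  proof (cases "2 < p")
    case True
    have nonneg: "0 \<le> clarkson_defect p a b" for a b
      using clarkson_defect_pos[OF True, of a b] clarkson_defect_zero[of a b p] by fastforce
    have iff: "clarkson_defect p a b = 0 \<longleftrightarrow> a * b = 0" for a b
      using clarkson_defect_pos[OF True, of a b] clarkson_defect_zero[of a b p] by fastforce
    show ?thesis
      using integral_nonneg_eq_0_iff_AE[OF int_D] nonneg iff by simp
  next
    case False
    then have "p < 2" using assms(2) by simp
    have nonneg: "0 \<le> - clarkson_defect p a b" for a b
      using clarkson_defect_neg[OF assms(1) \<open>p < 2\<close>, of a b] clarkson_defect_zero[of a b p]
      by fastforce
    have iff: "clarkson_defect p a b = 0 \<longleftrightarrow> a * b = 0" for a b
      using clarkson_defect_neg[OF assms(1) \<open>p < 2\<close>, of a b] clarkson_defect_zero[of a b p]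
      by fastforce
    show ?thesis
      using integral_nonneg_eq_0_iff_AE[of M "\<lambda>y. - ?D y"] int_D nonneg iff by simp
  qed
  then show ?thesis using eq by auto
qed

text \<open>
  Convergence in \<open>L\<^sup>p\<close> gives convergence almost everywhere along a subsequence, so a product that
  vanishes on \<open>A\<close> along the sequences also vanishes on \<open>A\<close> in the limit.
\<close>
lemma AE_disjoint_limit:
  fixes a b :: "nat \<Rightarrow> 'y \<Rightarrow> complex"
  assumes p: "0 < p"
    and Lp: "\<And>n. a n \<in> Lp_functions p M" "\<And>n. b n \<in> Lp_functions p M"
    and lim: "(\<lambda>n. \<integral>y. cmod (a n y) powr p \<partial>M) \<longlonglongrightarrow> 0" "(\<lambda>n. \<integral>y. cmod (b n y) powr p \<partial>M) \<longlonglongrightarrow> 0"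
    and zero: "\<And>n. AE y in M. y \<in> A \<longrightarrow> (\<xi> y + a n y) * (\<zeta> y + b n y) = 0"
  shows "AE y in M. y \<in> A \<longrightarrow> \<xi> y * \<zeta> y = 0"
proof -
  let ?u = "\<lambda>n y. cmod (a n y) powr p + cmod (b n y) powr p"
  have int: "integrable M (?u n)" for n
    using Lp_functions_integrable[OF Lp(1)] Lp_functions_integrable[OF Lp(2)] by auto
  have "(\<lambda>n. \<integral>y. norm (?u n y) \<partial>M) \<longlonglongrightarrow> 0"
    using tendsto_add[OF lim] Lp_functions_integrable[OF Lp(1)] Lp_functions_integrable[OF Lp(2)] by simp
  then obtain r where r: "AE y in M. (\<lambda>n. ?u (r n) y) \<longlonglongrightarrow> 0"
    using tendsto_L1_AE_subseq[of M ?u, OF int] by blast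
  have tendsto_0: "c \<longlonglongrightarrow> 0" if "v \<longlonglongrightarrow> 0" "\<And>n. cmod (c n) powr p \<le> v n" for c :: "nat \<Rightarrow> complex" and v
  proof -
    have "(\<lambda>n. cmod (c n) powr p) \<longlonglongrightarrow> 0"
      by (rule tendsto_sandwich[OF _ _ tendsto_const that(1)]) (use that(2) in auto)
    then have "(\<lambda>n. (cmod (c n) powr p) powr (1 / p)) \<longlonglongrightarrow> 0"
      by (rule tendsto_zero_powrI[where b = "1 / p"]) (use p in auto)
    then show ?thesis
      using p by (simp add: powr_powr tendsto_norm_zero_iff)
  qed
  have "AE y in M. \<forall>n. y \<in> A \<longrightarrow> (\<xi> y + a n y) * (\<zeta> y + b n y) = 0"
    unfolding AE_all_countable using zero by blast
  then show ?thesis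
    using r
  proof eventually_elim
    case (elim y)
    show ?case
    proof
      assume "y \<in> A"
      have "(\<lambda>n. a (r n) y) \<longlonglongrightarrow> 0" "(\<lambda>n. b (r n) y) \<longlonglongrightarrow> 0"
        by (rule tendsto_0[OF elim(2)], simp)+
      then have "(\<lambda>n. (\<xi> y + a (r n) y) * (\<zeta> y + b (r n) y)) \<longlonglongrightarrow> (\<xi> y + 0) * (\<zeta> y + 0)"
        by (intro tendsto_intros)
      then show "\<xi> y * \<zeta> y = 0"
        using elim(1) \<open>y \<in> A\<close> by (simp add: LIMSEQ_const_iff)
    qed
  qed
qed

section \<open>Classes of \<open>p\<close>-integrable functions and bounded operators on them\<close>

lemma Lp_space_simps:
  "carrier (Lp_space p M) = ae_class M ` Lp_functions p M"
  "add (Lp_space p M) F G = ae_class M (\<lambda>y. rep F y + rep G y)"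
  "smult (Lp_space p M) c F = ae_class M (\<lambda>y. c * rep F y)"
  "mnorm (Lp_space p M) F = (\<integral>y. cmod (rep F y) powr p \<partial>M) powr (1 / p)"
  by (simp_all add: Lp_space_def Lp_functions_def)

lemma ae_class_eqI:
  assumes "AE y in M. f y = g y"
  shows "ae_class M f = ae_class M g"
proof -
  have "(AE y in M. h y = f y) \<longleftrightarrow> (AE y in M. h y = g y)" for h
    by (rule eventually_subst) (use assms in \<open>eventually_elim, simp\<close>)
  then show ?thesis by (simp add: ae_class_def)
qed

lemma ae_class_rep:
  assumes "F \<in> carrier (Lp_space p M)" "0 \<le> p"
  shows "rep F \<in> Lp_functions p M" and "ae_class M (rep F) = F"
proof -
  obtain \<xi> where \<xi>: "\<xi> \<in> Lp_functions p M" and F: "F = ae_class M \<xi>"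
    using assms(1) by (auto simp: Lp_space_simps)
  note rep = rep_ae_class[OF Lp_functions_measurable[OF \<xi>]]
  show "rep F \<in> Lp_functions p M"
    unfolding F by (rule Lp_functions_cong_AE[OF \<xi> rep(1) assms(2) rep(2)])
  show "ae_class M (rep F) = F"
    unfolding F by (rule ae_class_eqI[OF rep(2)])
qed

lemma Lp_add_ae_class:
  assumes "\<xi> \<in> borel_measurable M" "\<eta> \<in> borel_measurable M"
  shows "ae_class M \<xi> \<oplus>\<^bsub>Lp_space p M\<^esub> ae_class M \<eta> = ae_class M (\<lambda>y. \<xi> y + \<eta> y)"
  unfolding Lp_space_simps
  by (rule ae_class_eqI)
    (use rep_ae_class(2)[OF assms(1)] rep_ae_class(2)[OF assms(2)] in \<open>eventually_elim, simp\<close>)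

lemma Lp_smult_ae_class:
  assumes "\<xi> \<in> borel_measurable M"
  shows "c \<odot>\<^bsub>Lp_space p M\<^esub> ae_class M \<xi> = ae_class M (\<lambda>y. c * \<xi> y)"
  unfolding Lp_space_simps
  by (rule ae_class_eqI) (use rep_ae_class(2)[OF assms(1)] in \<open>eventually_elim, simp\<close>)

lemma Lp_mnorm_ae_class:
  assumes "\<xi> \<in> borel_measurable M"
  shows "mnorm (Lp_space p M) (ae_class M \<xi>) = (\<integral>y. cmod (\<xi> y) powr p \<partial>M) powr (1 / p)"
proof -
  note [measurable] = assms rep_ae_class(1)[OF assms]
  have "(\<integral>y. cmod (rep (ae_class M \<xi>) y) powr p \<partial>M) = (\<integral>y. cmod (\<xi> y) powr p \<partial>M)"
  proof (rule integral_cong_AE)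
    show "AE y in M. cmod (rep (ae_class M \<xi>) y) powr p = cmod (\<xi> y) powr p"
      using rep_ae_class(2)[OF assms] by eventually_elim simp
  qed measurable
  then show ?thesis by (simp add: Lp_space_simps)
qed

lemma Lp_mnorm_nonneg: "0 \<le> mnorm (Lp_space p M) F"
  by (simp add: Lp_space_simps)

lemma Lp_mnorm_smult:
  assumes "F \<in> carrier (Lp_space p M)" "0 < p"
  shows "c \<odot>\<^bsub>Lp_space p M\<^esub> F \<in> carrier (Lp_space p M)"
    and "mnorm (Lp_space p M) (c \<odot>\<^bsub>Lp_space p M\<^esub> F) = cmod c * mnorm (Lp_space p M) F"
proof -
  obtain \<xi> where \<xi>: "\<xi> \<in> Lp_functions p M" and F: "F = ae_class M \<xi>"
    using assms(1) by (auto simp: Lp_space_simps)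
  note [measurable] = Lp_functions_measurable[OF \<xi>]
  have smult: "c \<odot>\<^bsub>Lp_space p M\<^esub> F = ae_class M (\<lambda>y. c * \<xi> y)"
    unfolding F by (rule Lp_smult_ae_class) measurable
  show "c \<odot>\<^bsub>Lp_space p M\<^esub> F \<in> carrier (Lp_space p M)"
    using smult Lp_functions_cmult[OF \<xi>] by (simp add: Lp_space_simps(1))
  show "mnorm (Lp_space p M) (c \<odot>\<^bsub>Lp_space p M\<^esub> F) = cmod c * mnorm (Lp_space p M) F"
    unfolding smult unfolding F
    using assms(2) by (simp add: Lp_mnorm_ae_class norm_mult powr_mult powr_powr)
qed

text \<open>
  The operator norm is a supremum over the unit ball, which bounds its members only because the
  operator is bounded.  A class of norm zero cannot be rescaled to norm one; for it the
  claim follows from boundedness as well.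
\<close>
lemma mnorm_operator_le:
  assumes T: "T \<in> carrier (bounded_operators (Lp_space p M))"
    and F: "F \<in> carrier (Lp_space p M)" and "0 < p"
  shows "mnorm (Lp_space p M) (T F)
    \<le> mnorm (bounded_operators (Lp_space p M)) T * mnorm (Lp_space p M) F"
proof -
  let ?E = "Lp_space p M"
  let ?B = "{G \<in> carrier ?E. mnorm ?E G \<le> 1}"
  have "\<exists>K. \<forall>G\<in>carrier ?E. mnorm ?E (T G) \<le> K * mnorm ?E G"
    using T by (simp add: bounded_operators_def)
  then obtain K where K: "\<And>G. G \<in> carrier ?E \<Longrightarrow> mnorm ?E (T G) \<le> K * mnorm ?E G"
    by blast
  have smult: "T (c \<odot>\<^bsub>?E\<^esub> F) = c \<odot>\<^bsub>?E\<^esub> T F" for c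
    using T F by (auto simp: bounded_operators_def)
  have TF: "T F \<in> carrier ?E"
    using T F by (auto simp: bounded_operators_def)
  show ?thesis
  proof (cases "mnorm ?E F = 0")
    case True
    then show ?thesis using K[OF F] by simp
  next
    case False
    then have pos: "0 < mnorm ?E F"
      using Lp_mnorm_nonneg[of p M F] by linarith
    define c where "c = complex_of_real (1 / mnorm ?E F)"
    have norm_c: "cmod c = 1 / mnorm ?E F"
      using pos by (simp add: c_def norm_divide)
    have in_ball: "c \<odot>\<^bsub>?E\<^esub> F \<in> ?B"
      using Lp_mnorm_smult[OF F assms(3), of c] norm_c pos by simp
    have "mnorm ?E (T G) \<le> \<bar>K\<bar>" if "G \<in> ?B" for G
    proof -
      have "K * mnorm ?E G \<le> \<bar>K\<bar> * 1"
        using that Lp_mnorm_nonneg[of p M G] by (intro mult_mono) auto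
      then show ?thesis using K[of G] that by auto
    qed
    then have "bdd_above ((\<lambda>G. mnorm ?E (T G)) ` ?B)"
      by (intro bdd_aboveI2) blast
    then have "mnorm ?E (T (c \<odot>\<^bsub>?E\<^esub> F)) \<le> mnorm (bounded_operators ?E) T"
      using in_ball by (auto simp: bounded_operators_def intro: cSUP_upper)
    then have "cmod c * mnorm ?E (T F) \<le> mnorm (bounded_operators ?E) T"
      using Lp_mnorm_smult(2)[OF TF assms(3), of c] by (simp add: smult)
    then show ?thesis
      using pos by (simp add: norm_c field_simps)
  qed
qed

section \<open>Continuous complex functions\<close>

lemma continuous_map_complex_mult:
  fixes f g :: "'x \<Rightarrow> complex"
  assumes "continuous_map X euclidean f" "continuous_map X euclidean g"
  shows "continuous_map X euclidean (\<lambda>x. f x * g x)"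
  using assms by (simp add: continuous_map_atin tendsto_mult)

lemma continuous_map_comp_continuous:
  assumes "continuous_map X euclidean f" "continuous_on UNIV g"
  shows "continuous_map X euclidean (\<lambda>x. g (f x))"
  using continuous_map_compose[OF assms(1), of euclidean g] assms(2) by (simp add: o_def)

lemma continuous_map_Re_Im:
  assumes "continuous_map X euclidean f"
  shows "continuous_map X euclideanreal (\<lambda>x. Re (f x))" "continuous_map X euclideanreal (\<lambda>x. Im (f x))"
  by (rule continuous_map_comp_continuous[OF assms], intro continuous_intros)+

lemma continuous_map_complex_of_real:
  "continuous_map X euclideanreal g \<Longrightarrow> continuous_map X euclidean (\<lambda>x. complex_of_real (g x))"
  by (erule continuous_map_comp_continuous[where g = complex_of_real]) (intro continuous_intros)

lemma cmod_cis_minus_one_le: "cmod (cis t - 1) \<le> \<bar>t\<bar>"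
  using Taylor_exp[of "\<i> * of_real t" 0] by (simp add: cis_conv_exp norm_mult)

lemma cmod_cis_minus_linear_le: "cmod (cis t - 1 - \<i> * of_real t) \<le> t\<^sup>2"
  using Taylor_exp[of "\<i> * of_real t" 1]
  by (simp add: cis_conv_exp norm_mult diff_diff_eq power2_eq_square)

section \<open>Contractive representations as actions on functions\<close>

text \<open>
  The function \<open>w\<close> is a reference vector at which operators are evaluated.  Having no zeros, it
  detects every set of positive measure; this is the form in which \<open>\<sigma>\<close>-finiteness enters.
\<close>
locale contractive_rep_on_Lp =
  fixes p :: real and X :: "'x topology" and M :: "'y measure"
    and \<pi> :: "('x \<Rightarrow> complex) \<Rightarrow> (('y \<Rightarrow> complex) set \<Rightarrow> ('y \<Rightarrow> complex) set)"
    and w :: "'y \<Rightarrow> complex"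
  assumes p_ge_1: "1 \<le> p" and p_neq_2: "p \<noteq> 2"
    and compact_X: "compact_space X"
    and hom_\<pi>: "unital_algebra_hom (C_algebra X) (bounded_operators (Lp_space p M)) \<pi>"
    and contractive_\<pi>: "contractive (C_algebra X) (bounded_operators (Lp_space p M)) \<pi>"
    and w_Lp: "w \<in> Lp_functions p M" and w_nonzero: "\<And>y. w y \<noteq> 0"
begin

abbreviation cont :: "('x \<Rightarrow> complex) \<Rightarrow> bool" where
  "cont f \<equiv> continuous_map X euclidean f"

abbreviation "Lp \<equiv> Lp_functions p M"

abbreviation mass :: "('y \<Rightarrow> complex) \<Rightarrow> real" where
  "mass \<xi> \<equiv> \<integral>y. cmod (\<xi> y) powr p \<partial>M"

text \<open>
  The operator \<open>\<pi>(f)\<close> transported from classes to functions, so that supports and pointwise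
  estimates can be discussed.  The restriction makes arbitrary extensions of \<open>f\<close> outside \<open>X\<close>
  harmless, so pointwise expressions such as \<open>\<lambda>x. f x + g x\<close> may be inserted directly.
\<close>
definition act :: "('x \<Rightarrow> complex) \<Rightarrow> ('y \<Rightarrow> complex) \<Rightarrow> 'y \<Rightarrow> complex" where
  "act f \<xi> = rep (\<pi> (restrict f (topspace X)) (ae_class M \<xi>))"

lemma p_pos: "0 < p" "0 \<le> p"
  using p_ge_1 by auto

lemma restrict_in_C: "cont f \<Longrightarrow> restrict f (topspace X) \<in> carrier (C_algebra X)"
  by (auto simp: C_algebra_def intro: continuous_map_eq)

lemma operator_\<pi>: "cont f \<Longrightarrow> \<pi> (restrict f (topspace X)) \<in> carrier (bounded_operators (Lp_space p M))"
  using hom_\<pi> restrict_in_C by (auto simp: unital_algebra_hom_def ring_hom_def)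

lemma ae_class_in_Lp_space: "\<xi> \<in> Lp \<Longrightarrow> ae_class M \<xi> \<in> carrier (Lp_space p M)"
  by (simp add: Lp_space_simps)

lemma operator_in_Lp_space:
  assumes "cont f" "\<xi> \<in> Lp"
  shows "\<pi> (restrict f (topspace X)) (ae_class M \<xi>) \<in> carrier (Lp_space p M)"
  using operator_\<pi>[OF assms(1)] ae_class_in_Lp_space[OF assms(2)] by (auto simp: bounded_operators_def)

lemma act_Lp: "cont f \<Longrightarrow> \<xi> \<in> Lp \<Longrightarrow> act f \<xi> \<in> Lp"
  unfolding act_def by (rule ae_class_rep(1)[OF operator_in_Lp_space p_pos(2)])

lemma ae_class_act:
  "cont f \<Longrightarrow> \<xi> \<in> Lp \<Longrightarrow> ae_class M (act f \<xi>) = \<pi> (restrict f (topspace X)) (ae_class M \<xi>)"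
  unfolding act_def by (rule ae_class_rep(2)[OF operator_in_Lp_space p_pos(2)])

lemma act_measurable: "cont f \<Longrightarrow> \<xi> \<in> Lp \<Longrightarrow> act f \<xi> \<in> borel_measurable M"
  by (rule Lp_functions_measurable[OF act_Lp])

lemma act_cong:
  assumes "AE y in M. \<xi> y = \<eta> y"
  shows "act f \<xi> = act f \<eta>"
  unfolding act_def ae_class_eqI[OF assms] ..

lemma act_AE_eqI:
  assumes "cont f" "\<xi> \<in> Lp" "\<pi> (restrict f (topspace X)) (ae_class M \<xi>) = ae_class M \<eta>"
  shows "AE y in M. act f \<xi> y = \<eta> y"
  using assms ae_class_act[OF assms(1,2)] ae_class_eq_iff[OF act_measurable[OF assms(1,2)], of \<eta>]
  by simp

lemma act_add:
  assumes "cont f" "\<xi> \<in> Lp" "\<eta> \<in> Lp"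
  shows "AE y in M. act f (\<lambda>y. \<xi> y + \<eta> y) y = act f \<xi> y + act f \<eta> y"
proof (rule act_AE_eqI[OF assms(1) Lp_functions_add[OF assms(2,3) p_pos(2)]])
  let ?T = "\<pi> (restrict f (topspace X))"
  note meas = Lp_functions_measurable[OF assms(2)] Lp_functions_measurable[OF assms(3)]
    act_measurable[OF assms(1,2)] act_measurable[OF assms(1,3)]
  have "?T (ae_class M (\<lambda>y. \<xi> y + \<eta> y)) = ?T (ae_class M \<xi> \<oplus>\<^bsub>Lp_space p M\<^esub> ae_class M \<eta>)"
    by (simp add: Lp_add_ae_class meas)
  also have "\<dots> = ?T (ae_class M \<xi>) \<oplus>\<^bsub>Lp_space p M\<^esub> ?T (ae_class M \<eta>)"
    using operator_\<pi>[OF assms(1)] ae_class_in_Lp_space assms(2,3) by (auto simp: bounded_operators_def)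
  also have "\<dots> = ae_class M (\<lambda>y. act f \<xi> y + act f \<eta> y)"
    unfolding ae_class_act[OF assms(1,2), symmetric] ae_class_act[OF assms(1,3), symmetric]
    by (simp add: Lp_add_ae_class meas)
  finally show "?T (ae_class M (\<lambda>y. \<xi> y + \<eta> y)) = ae_class M (\<lambda>y. act f \<xi> y + act f \<eta> y)" .
qed

lemma act_cmult:
  assumes "cont f" "\<xi> \<in> Lp"
  shows "AE y in M. act f (\<lambda>y. c * \<xi> y) y = c * act f \<xi> y"
proof (rule act_AE_eqI[OF assms(1) Lp_functions_cmult[OF assms(2)]])
  let ?T = "\<pi> (restrict f (topspace X))"
  note meas = Lp_functions_measurable[OF assms(2)] act_measurable[OF assms]
  have "?T (ae_class M (\<lambda>y. c * \<xi> y)) = ?T (c \<odot>\<^bsub>Lp_space p M\<^esub> ae_class M \<xi>)"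
    by (simp add: Lp_smult_ae_class meas)
  also have "\<dots> = c \<odot>\<^bsub>Lp_space p M\<^esub> ?T (ae_class M \<xi>)"
    using operator_\<pi>[OF assms(1)] ae_class_in_Lp_space assms(2) by (auto simp: bounded_operators_def)
  also have "\<dots> = ae_class M (\<lambda>y. c * act f \<xi> y)"
    unfolding ae_class_act[OF assms, symmetric] by (simp add: Lp_smult_ae_class meas)
  finally show "?T (ae_class M (\<lambda>y. c * \<xi> y)) = ae_class M (\<lambda>y. c * act f \<xi> y)" .
qed

lemma act_diff:
  assumes "cont f" "\<xi> \<in> Lp" "\<eta> \<in> Lp"
  shows "AE y in M. act f (\<lambda>y. \<xi> y - \<eta> y) y = act f \<xi> y - act f \<eta> y"
  using act_add[OF assms(1,2) Lp_functions_cmult[OF assms(3), of "-1"]]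
    act_cmult[OF assms(1,3), of "-1"]
  by (eventually_elim) simp

lemma act_fun_add:
  assumes "cont f" "cont g" "\<xi> \<in> Lp"
  shows "AE y in M. act (\<lambda>x. f x + g x) \<xi> y = act f \<xi> y + act g \<xi> y"
proof (rule act_AE_eqI[OF continuous_map_add[OF assms(1,2)] assms(3)])
  let ?R = "\<lambda>f. restrict f (topspace X)"
  have "?R (\<lambda>x. f x + g x) = ?R f \<oplus>\<^bsub>C_algebra X\<^esub> ?R g"
    by (auto simp: C_algebra_def)
  then have "\<pi> (?R (\<lambda>x. f x + g x)) = \<pi> (?R f) \<oplus>\<^bsub>bounded_operators (Lp_space p M)\<^esub> \<pi> (?R g)"
    using hom_\<pi> restrict_in_C assms by (auto simp: unital_algebra_hom_def ring_hom_def)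
  then have "\<pi> (?R (\<lambda>x. f x + g x)) (ae_class M \<xi>)
      = \<pi> (?R f) (ae_class M \<xi>) \<oplus>\<^bsub>Lp_space p M\<^esub> \<pi> (?R g) (ae_class M \<xi>)"
    using ae_class_in_Lp_space[OF assms(3)] by (simp add: bounded_operators_def)
  also have "\<dots> = ae_class M (\<lambda>y. act f \<xi> y + act g \<xi> y)"
    unfolding ae_class_act[OF assms(1,3), symmetric] ae_class_act[OF assms(2,3), symmetric]
    by (simp add: Lp_add_ae_class act_measurable assms)
  finally show "\<pi> (?R (\<lambda>x. f x + g x)) (ae_class M \<xi>) = ae_class M (\<lambda>y. act f \<xi> y + act g \<xi> y)" .
qed

lemma act_fun_cmult:
  assumes "cont f" "\<xi> \<in> Lp"
  shows "AE y in M. act (\<lambda>x. c * f x) \<xi> y = c * act f \<xi> y"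
proof (rule act_AE_eqI[OF _ assms(2)])
  show "cont (\<lambda>x. c * f x)"
    by (intro continuous_map_complex_mult assms) auto
  let ?R = "\<lambda>f. restrict f (topspace X)"
  have "?R (\<lambda>x. c * f x) = c \<odot>\<^bsub>C_algebra X\<^esub> ?R f"
    by (auto simp: C_algebra_def)
  then have "\<pi> (?R (\<lambda>x. c * f x)) = c \<odot>\<^bsub>bounded_operators (Lp_space p M)\<^esub> \<pi> (?R f)"
    using hom_\<pi> restrict_in_C assms by (auto simp: unital_algebra_hom_def)
  then have "\<pi> (?R (\<lambda>x. c * f x)) (ae_class M \<xi>) = c \<odot>\<^bsub>Lp_space p M\<^esub> \<pi> (?R f) (ae_class M \<xi>)"
    using ae_class_in_Lp_space[OF assms(2)] by (simp add: bounded_operators_def)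
  also have "\<dots> = ae_class M (\<lambda>y. c * act f \<xi> y)"
    unfolding ae_class_act[OF assms, symmetric]
    by (simp add: Lp_smult_ae_class act_measurable assms)
  finally show "\<pi> (?R (\<lambda>x. c * f x)) (ae_class M \<xi>) = ae_class M (\<lambda>y. c * act f \<xi> y)" .
qed

lemma act_fun_mult:
  assumes "cont f" "cont g" "\<xi> \<in> Lp"
  shows "AE y in M. act (\<lambda>x. f x * g x) \<xi> y = act f (act g \<xi>) y"
proof (rule act_AE_eqI[OF continuous_map_complex_mult[OF assms(1,2)] assms(3)])
  let ?R = "\<lambda>f. restrict f (topspace X)"
  have "?R (\<lambda>x. f x * g x) = ?R f \<otimes>\<^bsub>C_algebra X\<^esub> ?R g"
    by (auto simp: C_algebra_def)
  then have "\<pi> (?R (\<lambda>x. f x * g x)) = \<pi> (?R f) \<otimes>\<^bsub>bounded_operators (Lp_space p M)\<^esub> \<pi> (?R g)"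
    using hom_\<pi> restrict_in_C assms by (auto simp: unital_algebra_hom_def ring_hom_def)
  then have "\<pi> (?R (\<lambda>x. f x * g x)) (ae_class M \<xi>) = \<pi> (?R f) (\<pi> (?R g) (ae_class M \<xi>))"
    using ae_class_in_Lp_space[OF assms(3)] by (simp add: bounded_operators_def compose_def)
  also have "\<dots> = ae_class M (act f (act g \<xi>))"
    by (simp add: ae_class_act assms act_Lp)
  finally show "\<pi> (?R (\<lambda>x. f x * g x)) (ae_class M \<xi>) = ae_class M (act f (act g \<xi>))" .
qed

lemma act_one:
  assumes "\<xi> \<in> Lp"
  shows "AE y in M. act (\<lambda>x. 1) \<xi> y = \<xi> y"
proof (rule act_AE_eqI[OF _ assms])
  have "\<pi> (restrict (\<lambda>x. 1) (topspace X)) = \<pi> \<one>\<^bsub>C_algebra X\<^esub>"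
    by (simp add: C_algebra_def)
  also have "\<dots> = \<one>\<^bsub>bounded_operators (Lp_space p M)\<^esub>"
    using hom_\<pi> by (simp add: unital_algebra_hom_def ring_hom_def)
  finally show "\<pi> (restrict (\<lambda>x. 1) (topspace X)) (ae_class M \<xi>) = ae_class M \<xi>"
    using ae_class_in_Lp_space[OF assms] by (simp add: bounded_operators_def)
qed simp

lemma cont_bounded:
  assumes "cont f"
  obtains K where "0 \<le> K" "\<And>x. x \<in> topspace X \<Longrightarrow> cmod (f x) \<le> K"
proof -
  have "compactin euclidean (f ` topspace X)"
    using image_compactin[of X "topspace X" euclidean f] compact_X assms by (simp add: compact_space_def)
  then have "bounded (f ` topspace X)"
    by (simp add: compact_imp_bounded)
  then obtain K where "0 < K" "\<forall>z\<in>f ` topspace X. cmod z \<le> K"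
    by (auto simp: bounded_pos)
  then show ?thesis using that[of K] by auto
qed

lemma mass_act_le:
  assumes "cont f" "\<xi> \<in> Lp" "0 \<le> K" and bound: "\<And>x. x \<in> topspace X \<Longrightarrow> cmod (f x) \<le> K"
  shows "mass (act f \<xi>) \<le> K powr p * mass \<xi>"
proof -
  let ?f = "restrict f (topspace X)"
  let ?norm = "mnorm (Lp_space p M)"
  have "mnorm (bounded_operators (Lp_space p M)) (\<pi> ?f) \<le> mnorm (C_algebra X) ?f"
    using contractive_\<pi> restrict_in_C[OF assms(1)] by (simp add: contractive_def)
  also have "\<dots> \<le> K"
    unfolding C_algebra_def using bound assms(3) by (auto intro!: cSup_least)
  finally have "mnorm (bounded_operators (Lp_space p M)) (\<pi> ?f) * ?norm (ae_class M \<xi>)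
      \<le> K * ?norm (ae_class M \<xi>)"
    by (intro mult_right_mono Lp_mnorm_nonneg)
  then have "?norm (ae_class M (act f \<xi>)) \<le> K * ?norm (ae_class M \<xi>)"
    using mnorm_operator_le[OF operator_\<pi>[OF assms(1)] ae_class_in_Lp_space[OF assms(2)] p_pos(1)]
    by (simp add: ae_class_act assms)
  then have "mass (act f \<xi>) powr (1 / p) \<le> K * mass \<xi> powr (1 / p)"
    by (simp add: Lp_mnorm_ae_class Lp_functions_measurable[OF assms(2)] act_measurable[OF assms(1,2)])
  then have "(mass (act f \<xi>) powr (1 / p)) powr p \<le> (K * mass \<xi> powr (1 / p)) powr p"
    using p_pos by (intro powr_mono2) auto
  then show ?thesis
    using p_pos by (simp add: powr_powr powr_mult assms)
qed

section \<open>Isometries preserve disjointness, generators preserve supports\<close>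

text \<open>
  Both \<open>\<pi>(u)\<close> and its inverse \<open>\<pi>(cnj u)\<close> are contractions.
\<close>
lemma mass_act_unimodular:
  assumes "cont u" "\<And>x. x \<in> topspace X \<Longrightarrow> cmod (u x) = 1" "\<xi> \<in> Lp"
  shows "mass (act u \<xi>) = mass \<xi>"
proof (rule antisym)
  show "mass (act u \<xi>) \<le> mass \<xi>"
    using mass_act_le[OF assms(1,3), of 1] assms(2) by simp
  have cnj: "cont (\<lambda>x. cnj (u x))"
    by (rule continuous_map_comp_continuous[OF assms(1)]) (intro continuous_intros)
  have one: "restrict (\<lambda>x. cnj (u x) * u x) (topspace X) = restrict (\<lambda>x. 1) (topspace X)"
    using assms(2) by (auto simp: complex_norm_square[symmetric] mult.commute)
  have "AE y in M. act (\<lambda>x. cnj (u x)) (act u \<xi>) y = \<xi> y"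
    using act_fun_mult[OF cnj assms(1,3)] act_one[OF assms(3)]
    by eventually_elim (use one in \<open>simp add: act_def\<close>)
  then have "mass (act (\<lambda>x. cnj (u x)) (act u \<xi>)) = mass \<xi>"
    using act_measurable[OF cnj act_Lp[OF assms(1,3)]] Lp_functions_measurable[OF assms(3)]
    by (intro integral_cong_AE) auto
  then show "mass \<xi> \<le> mass (act u \<xi>)"
    using mass_act_le[OF cnj act_Lp[OF assms(1,3)], of 1] assms(2) by simp
qed

text \<open>
  Disjointness is a relation between the norms of \<open>\<xi>\<close>, \<open>\<eta>\<close>, \<open>\<xi> + \<eta>\<close> and \<open>\<xi> - \<eta>\<close>, all of which are
  preserved.  This is where \<open>p \<noteq> 2\<close> is essential.
\<close>
lemma act_unimodular_disjoint:
  assumes u: "cont u" "\<And>x. x \<in> topspace X \<Longrightarrow> cmod (u x) = 1"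
    and \<xi>: "\<xi> \<in> Lp" and \<eta>: "\<eta> \<in> Lp" and "AE y in M. \<xi> y * \<eta> y = 0"
  shows "AE y in M. act u \<xi> y * act u \<eta> y = 0"
proof -
  note meas = act_measurable[OF u(1) \<xi>] act_measurable[OF u(1) \<eta>]
  note sum = Lp_functions_add[OF \<xi> \<eta> p_pos(2)] and diff = Lp_functions_diff[OF \<xi> \<eta> p_pos(2)]
  have "mass (\<lambda>y. act u \<xi> y + act u \<eta> y) = mass (act u (\<lambda>y. \<xi> y + \<eta> y))"
    using act_add[OF u(1) \<xi> \<eta>] meas act_measurable[OF u(1) sum] by (intro integral_cong_AE) auto
  moreover have "mass (\<lambda>y. act u \<xi> y - act u \<eta> y) = mass (act u (\<lambda>y. \<xi> y - \<eta> y))"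
    using act_diff[OF u(1) \<xi> \<eta>] meas act_measurable[OF u(1) diff] by (intro integral_cong_AE) auto
  ultimately show ?thesis
    using disjoint_iff_clarkson_equality[OF p_pos(1) p_neq_2 \<xi> \<eta>] assms(5)
      disjoint_iff_clarkson_equality[OF p_pos(1) p_neq_2 act_Lp[OF u(1) \<xi>] act_Lp[OF u(1) \<eta>]]
      mass_act_unimodular[OF u] \<xi> \<eta> sum diff
    by simp
qed

text \<open>
  For small \<open>t > 0\<close> put \<open>u = exp(i t g)\<close>, \<open>v = u - 1\<close> and \<open>q = v/t - i g\<close>; then \<open>v\<close> and \<open>q\<close> are of
  size \<open>t\<close>, uniformly on \<open>X\<close>.  The product \<open>\<pi>(u)\<xi> \<cdot> \<pi>(u)\<eta>\<close> vanishes, and where \<open>\<eta> = 0\<close> it equals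
  \<open>(\<xi> + \<pi>(v)\<xi>) \<cdot> t (i \<pi>(g)\<eta> + \<pi>(q)\<eta>)\<close>.  Dividing by \<open>t\<close> and letting \<open>t\<close> tend to \<open>0\<close> gives
  \<open>\<xi> \<cdot> \<pi>(g)\<eta> = 0\<close> there; where \<open>\<eta> \<noteq> 0\<close>, already \<open>\<xi> = 0\<close>.
\<close>
lemma act_real_local:
  fixes g :: "'x \<Rightarrow> real"
  assumes g: "continuous_map X euclideanreal g"
    and \<xi>: "\<xi> \<in> Lp" and \<eta>: "\<eta> \<in> Lp" and disj: "AE y in M. \<xi> y * \<eta> y = 0"
  shows "AE y in M. \<xi> y * act (\<lambda>x. of_real (g x)) \<eta> y = 0"
proof -
  let ?f = "\<lambda>x. complex_of_real (g x)"
  have cont_f: "cont ?f"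
    by (rule continuous_map_complex_of_real[OF g])
  obtain B where B: "0 \<le> B" "\<And>x. x \<in> topspace X \<Longrightarrow> \<bar>g x\<bar> \<le> B"
    using cont_bounded[OF cont_f] by (metis norm_of_real real_norm_def)
  define t where "t n = inverse (real (Suc n))" for n
  have t_pos: "0 < t n" for n by (simp add: t_def)
  have t_lim: "t \<longlonglongrightarrow> 0" unfolding t_def by (rule LIMSEQ_inverse_real_of_nat)
  define u where "u n x = cis (t n * g x)" for n x
  define v where "v n x = u n x - 1" for n x
  define q where "q n x = inverse (of_real (t n)) * v n x - \<i> * ?f x" for n x
  have cont_u: "cont (u n)" for n
    unfolding u_def by (rule continuous_map_comp_continuous[OF g]) (intro continuous_intros)
  have cont_v: "cont (v n)" for n
    unfolding v_def u_def by (rule continuous_map_comp_continuous[OF g]) (intro continuous_intros)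
  have cont_q: "cont (q n)" for n
    unfolding q_def v_def u_def by (rule continuous_map_comp_continuous[OF g]) (intro continuous_intros)
  have v_bound: "cmod (v n x) \<le> t n * B" if "x \<in> topspace X" for n x
  proof -
    have "cmod (v n x) \<le> \<bar>t n * g x\<bar>"
      unfolding v_def u_def by (rule cmod_cis_minus_one_le)
    also have "\<dots> \<le> t n * B"
      using B(2)[OF that] t_pos[of n] by (simp add: abs_mult)
    finally show ?thesis .
  qed
  have q_bound: "cmod (q n x) \<le> t n * B\<^sup>2" if "x \<in> topspace X" for n x
  proof -
    have "of_real (t n) * q n x = cis (t n * g x) - 1 - \<i> * of_real (t n * g x)"
      using t_pos[of n] by (simp add: q_def v_def u_def algebra_simps)
    then have "cmod (of_real (t n) * q n x) \<le> (t n * g x)\<^sup>2"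
      by (simp only: cmod_cis_minus_linear_le)
    then have "t n * cmod (q n x) \<le> t n * (t n * (g x)\<^sup>2)"
      using t_pos[of n] by (simp add: norm_mult power2_eq_square algebra_simps)
    then have "cmod (q n x) \<le> t n * (g x)\<^sup>2"
      using t_pos[of n] by simp
    also have "\<dots> \<le> t n * B\<^sup>2"
      using B(2)[OF that] t_pos[of n] by (intro mult_left_mono) (auto simp: abs_le_square_iff[symmetric])
    finally show ?thesis .
  qed
  have lim: "(\<lambda>n. mass (act (k n) \<zeta>)) \<longlonglongrightarrow> 0"
    if "\<And>n. cont (k n)" "\<And>n x. x \<in> topspace X \<Longrightarrow> cmod (k n x) \<le> t n * C" "0 \<le> C" "\<zeta> \<in> Lp" for k C \<zeta>
  proof (rule tendsto_sandwich[OF _ _ tendsto_const])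
    have "(\<lambda>n. (t n * C) powr p) \<longlonglongrightarrow> 0"
      by (rule tendsto_zero_powrI[where b = p])
        (use t_pos that(3) p_pos tendsto_mult_left_zero[OF t_lim, of C] in \<open>auto simp: less_imp_le\<close>)
    then show "(\<lambda>n. (t n * C) powr p * mass \<zeta>) \<longlonglongrightarrow> 0"
      by (rule tendsto_mult_left_zero)
    show "\<forall>\<^sub>F n in sequentially. mass (act (k n) \<zeta>) \<le> (t n * C) powr p * mass \<zeta>"
      using mass_act_le[OF that(1,4)] that(2,3) t_pos by (intro always_eventually allI) (simp add: less_imp_le)
  qed simp
  have u_eq: "AE y in M. act (u n) \<zeta> y = \<zeta> y + act (v n) \<zeta> y" if "\<zeta> \<in> Lp" for n \<zeta>
  proof -
    have eq: "u n = (\<lambda>x. 1 + v n x)" by (simp add: v_def fun_eq_iff)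
    have "AE y in M. act (u n) \<zeta> y = act (\<lambda>x. 1) \<zeta> y + act (v n) \<zeta> y"
      unfolding eq by (rule act_fun_add[OF _ cont_v that]) simp
    then show ?thesis
      using act_one[OF that] by eventually_elim simp
  qed
  have v_eq: "AE y in M. act (v n) \<eta> y = of_real (t n) * (\<i> * act ?f \<eta> y + act (q n) \<eta> y)" for n
  proof -
    have cont_if: "cont (\<lambda>x. \<i> * ?f x)"
      by (rule continuous_map_comp_continuous[OF g]) (intro continuous_intros)
    have cont_s: "cont (\<lambda>x. \<i> * ?f x + q n x)"
      by (rule continuous_map_add[OF cont_if cont_q])
    have eq: "v n = (\<lambda>x. of_real (t n) * (\<i> * ?f x + q n x))"
      using t_pos[of n] by (simp add: q_def fun_eq_iff)
    show ?thesis
      using act_fun_cmult[OF cont_s \<eta>, of "of_real (t n)", folded eq]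
        act_fun_add[OF cont_if cont_q \<eta>, of n] act_fun_cmult[OF cont_f \<eta>, of \<i>]
      by eventually_elim simp
  qed
  have "AE y in M. y \<in> {y. \<eta> y = 0} \<longrightarrow> \<xi> y * (\<i> * act ?f \<eta> y) = 0"
  proof (rule AE_disjoint_limit[OF p_pos(1)])
    show "(\<lambda>n. mass (act (v n) \<xi>)) \<longlonglongrightarrow> 0"
      by (rule lim[OF cont_v v_bound B(1) \<xi>])
    show "(\<lambda>n. mass (act (q n) \<eta>)) \<longlonglongrightarrow> 0"
      by (rule lim[OF cont_q q_bound _ \<eta>]) auto
    fix n
    have "AE y in M. act (u n) \<xi> y * act (u n) \<eta> y = 0"
      by (rule act_unimodular_disjoint[OF cont_u _ \<xi> \<eta> disj]) (simp add: u_def)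
    then show "AE y in M. y \<in> {y. \<eta> y = 0} \<longrightarrow>
        (\<xi> y + act (v n) \<xi> y) * (\<i> * act ?f \<eta> y + act (q n) \<eta> y) = 0"
      using u_eq[OF \<xi>, of n] u_eq[OF \<eta>, of n] v_eq[of n]
      by eventually_elim (use t_pos[of n] in auto)
  qed (auto intro: act_Lp cont_v cont_q \<xi> \<eta>)
  then show ?thesis
    using disj by eventually_elim auto
qed

lemma act_Re_Im:
  assumes "cont f" "\<xi> \<in> Lp"
  shows "AE y in M. act f \<xi> y = act (\<lambda>x. of_real (Re (f x))) \<xi> y + \<i> * act (\<lambda>x. of_real (Im (f x))) \<xi> y"
proof -
  let ?a = "\<lambda>x. complex_of_real (Re (f x))" and ?b = "\<lambda>x. complex_of_real (Im (f x))"
  note ab = continuous_map_complex_of_real[OF continuous_map_Re_Im(1)[OF assms(1)]] continuous_map_complex_of_real[OF continuous_map_Re_Im(2)[OF assms(1)]]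
  have ib: "cont (\<lambda>x. \<i> * ?b x)"
    by (intro continuous_map_complex_mult ab) auto
  have "f = (\<lambda>x. ?a x + \<i> * ?b x)" by (simp add: complex_eq fun_eq_iff)
  then have "AE y in M. act f \<xi> y = act ?a \<xi> y + act (\<lambda>x. \<i> * ?b x) \<xi> y"
    using act_fun_add[OF ab(1) ib assms(2)] by simp
  then show ?thesis
    using act_fun_cmult[OF ab(2) assms(2), of \<i>] by eventually_elim simp
qed

text \<open>
  Test the disjointness against \<open>w\<close> cut off to \<open>A\<close>, which has no zeros on \<open>A\<close>.
\<close>
lemma act_local:
  assumes f: "cont f" and \<eta>: "\<eta> \<in> Lp" and A: "A \<in> sets M" and zero: "AE y in M. y \<in> A \<longrightarrow> \<eta> y = 0"
  shows "AE y in M. y \<in> A \<longrightarrow> act f \<eta> y = 0"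
proof -
  let ?\<xi> = "\<lambda>y. indicator A y * w y"
  have \<xi>: "?\<xi> \<in> Lp"
    using A Lp_functions_measurable[OF w_Lp]
    by (intro Lp_functions_dominated[OF w_Lp _ p_pos(2)]) (auto simp: indicator_def)
  have disj: "AE y in M. ?\<xi> y * \<eta> y = 0"
    using zero by eventually_elim (auto simp: indicator_def)
  show ?thesis
    using act_real_local[OF continuous_map_Re_Im(1)[OF f] \<xi> \<eta> disj]
      act_real_local[OF continuous_map_Re_Im(2)[OF f] \<xi> \<eta> disj] act_Re_Im[OF f \<eta>]
    by eventually_elim (auto simp: indicator_def w_nonzero)
qed

section \<open>From supports to multiplication operators\<close>

text \<open>
  Let \<open>A\<close> be the set where the bound fails.  Since \<open>\<pi>(f)\<close> does not enlarge supports, it commutes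
  with cutting off to \<open>A\<close>, so the norm bound applied to \<open>\<xi>\<close> cut off to \<open>A\<close> says that
  \<open>|\<pi>(f)\<xi>|\<^sup>p - K\<^sup>p |\<xi>|\<^sup>p\<close> has integral at most \<open>0\<close> over \<open>A\<close>.  It is positive on \<open>A\<close>, so \<open>A\<close> is null.
\<close>
lemma act_pointwise_le:
  assumes f: "cont f" and \<xi>: "\<xi> \<in> Lp" and K: "0 \<le> K" "\<And>x. x \<in> topspace X \<Longrightarrow> cmod (f x) \<le> K"
  shows "AE y in M. cmod (act f \<xi> y) \<le> K * cmod (\<xi> y)"
proof -
  note [measurable] = Lp_functions_measurable[OF \<xi>] act_measurable[OF f \<xi>]
  define A where "A = {y \<in> space M. K * cmod (\<xi> y) < cmod (act f \<xi> y)}"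
  have A [measurable]: "A \<in> sets M" unfolding A_def by measurable
  have cut: "(\<lambda>y. indicator B y * \<zeta> y) \<in> Lp" if "B \<in> sets M" "\<zeta> \<in> Lp" for B \<zeta>
    using that Lp_functions_measurable[OF that(2)]
    by (intro Lp_functions_dominated[OF that(2) _ p_pos(2)]) (auto simp: indicator_def)
  define \<xi>1 where "\<xi>1 y = indicator A y * \<xi> y" for y
  define \<xi>2 where "\<xi>2 y = indicator (space M - A) y * \<xi> y" for y
  have Lp12: "\<xi>1 \<in> Lp" "\<xi>2 \<in> Lp"
    unfolding \<xi>1_def \<xi>2_def by (intro cut \<xi>; measurable)+
  have "AE y in M. \<xi> y = \<xi>1 y + \<xi>2 y"
    by (auto simp: \<xi>1_def \<xi>2_def indicator_def)
  then have split: "act f \<xi> = act f (\<lambda>y. \<xi>1 y + \<xi>2 y)" by (rule act_cong)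
  have "AE y in M. y \<in> space M - A \<longrightarrow> act f \<xi>1 y = 0"
    by (rule act_local[OF f Lp12(1)]) (auto simp: \<xi>1_def)
  moreover have "AE y in M. y \<in> A \<longrightarrow> act f \<xi>2 y = 0"
    by (rule act_local[OF f Lp12(2)]) (auto simp: \<xi>2_def)
  ultimately have "AE y in M. act f \<xi>1 y = indicator A y * act f \<xi> y"
    using act_add[OF f Lp12] AE_space unfolding split
    by eventually_elim (auto simp: indicator_def)
  then have "mass (act f \<xi>1) = mass (\<lambda>y. indicator A y * act f \<xi> y)"
    using act_measurable[OF f Lp12(1)] by (intro integral_cong_AE) auto
  then have le: "mass (\<lambda>y. indicator A y * act f \<xi> y) \<le> K powr p * mass \<xi>1"
    using mass_act_le[OF f Lp12(1) K] by simp
  define g where "g y = cmod (indicator A y * act f \<xi> y) powr p - K powr p * cmod (\<xi>1 y) powr p" for y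
  have int: "integrable M (\<lambda>y. cmod (indicator A y * act f \<xi> y) powr p)" "integrable M (\<lambda>y. cmod (\<xi>1 y) powr p)"
    by (rule Lp_functions_integrable[OF cut[OF A act_Lp[OF f \<xi>]]],
        rule Lp_functions_integrable[OF Lp12(1)])
  have strict: "(K * cmod (\<xi> y)) powr p < cmod (act f \<xi> y) powr p" if "y \<in> A" for y
    using that K(1) p_pos by (auto simp: A_def intro!: powr_less_mono2)
  have g_pos: "0 < g y" if "y \<in> A" for y
    using strict[OF that] that K(1) by (simp add: g_def \<xi>1_def powr_mult)
  have g_zero: "g y = 0" if "y \<notin> A" for y
    using that by (simp add: g_def \<xi>1_def)
  have nonneg: "0 \<le> g y" for y
    using g_pos[of y] g_zero[of y] by (cases "y \<in> A") auto
  have int_g: "integrable M g"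
    unfolding g_def using int by auto
  have "integral\<^sup>L M g \<le> 0"
    unfolding g_def using int le by simp
  then have "integral\<^sup>L M g = 0"
    using Bochner_Integration.integral_nonneg[of M g] nonneg by (intro antisym) auto
  then have "AE y in M. g y = 0"
    using integral_nonneg_eq_0_iff_AE[OF int_g] nonneg by simp
  then show ?thesis
    using AE_space
  proof eventually_elim
    case (elim y)
    then have "y \<notin> A" using g_pos[of y] by auto
    then show ?case using elim(2) by (simp add: A_def)
  qed
qed

definition symbol :: "('x \<Rightarrow> complex) \<Rightarrow> 'y \<Rightarrow> complex" where
  "symbol f y = act f w y / w y"

lemma symbol_measurable: "cont f \<Longrightarrow> symbol f \<in> borel_measurable M"
  using act_measurable[OF _ w_Lp, of f] Lp_functions_measurable[OF w_Lp] unfolding symbol_def by measurable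

lemma act_w: "act f w y = symbol f y * w y"
  by (simp add: symbol_def w_nonzero)

text \<open>
  Applied to \<open>\<xi> - c w\<close>, the pointwise bound holds off a single null set for all \<open>c\<close> in a countable
  dense set.  At such a point \<open>y\<close>, take \<open>c\<close> close to \<open>z = \<xi> y / w y\<close>.
\<close>
lemma act_eq_symbol_mult:
  assumes f: "cont f" and \<xi>: "\<xi> \<in> Lp"
  shows "AE y in M. act f \<xi> y = symbol f y * \<xi> y"
proof -
  obtain K where K: "0 \<le> K" "\<And>x. x \<in> topspace X \<Longrightarrow> cmod (f x) \<le> K"
    using cont_bounded[OF f] by blast
  obtain D :: "complex set" where D: "countable D" "\<And>U. open U \<Longrightarrow> U \<noteq> {} \<Longrightarrow> \<exists>d\<in>D. d \<in> U"
    using countable_dense_setE by blast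
  have "AE y in M. cmod (act f \<xi> y - c * act f w y) \<le> K * cmod (\<xi> y - c * w y)" for c
  proof -
    note cw = Lp_functions_cmult[OF w_Lp, of c]
    have "AE y in M. cmod (act f (\<lambda>y. \<xi> y - c * w y) y) \<le> K * cmod (\<xi> y - c * w y)"
      by (rule act_pointwise_le[OF f Lp_functions_diff[OF \<xi> cw p_pos(2)] K(1)]) (rule K(2))
    then show ?thesis
      using act_diff[OF f \<xi> cw] act_cmult[OF f w_Lp, of c] by eventually_elim simp
  qed
  then have "AE y in M. \<forall>c\<in>D. cmod (act f \<xi> y - c * act f w y) \<le> K * cmod (\<xi> y - c * w y)"
    by (simp add: AE_ball_countable[OF D(1)])
  then show ?thesis
  proof eventually_elim
    case (elim y)
    let ?b = "act f w y"
    define z where "z = \<xi> y / w y"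
    have \<xi>_eq: "\<xi> y = z * w y" by (simp add: z_def w_nonzero)
    define C where "C = K * cmod (w y) + cmod ?b"
    have "cmod (act f \<xi> y - z * ?b) \<le> C * e" if "0 < e" for e
    proof -
      obtain c where c: "c \<in> D" "c \<in> ball z e"
        using D(2)[of "ball z e"] \<open>0 < e\<close> by auto
      have "cmod (act f \<xi> y - z * ?b) \<le> cmod (act f \<xi> y - c * ?b) + cmod ((c - z) * ?b)"
        using norm_triangle_ineq[of "act f \<xi> y - c * ?b" "(c - z) * ?b"] by (simp add: algebra_simps)
      also have "\<dots> \<le> K * cmod ((z - c) * w y) + cmod ((c - z) * ?b)"
        using elim c(1) by (simp add: \<xi>_eq algebra_simps)
      also have "\<dots> = C * cmod (z - c)"
        by (simp add: C_def norm_mult norm_minus_commute[of c z] distrib_right)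
      also have "\<dots> \<le> C * e"
        using c(2) K(1) by (intro mult_left_mono) (auto simp: C_def dist_norm)
      finally show ?thesis .
    qed
    moreover have "((\<lambda>e. C * e) \<longlongrightarrow> C * 0) (at_right 0)"
      by (intro tendsto_intros)
    ultimately have "cmod (act f \<xi> y - z * ?b) \<le> C * 0"
      by (intro tendsto_lowerbound) (auto simp: eventually_at_filter)
    then show ?case
      by (simp add: z_def symbol_def)
  qed
qed

lemma symbol_le:
  assumes "cont f" "0 \<le> K" "\<And>x. x \<in> topspace X \<Longrightarrow> cmod (f x) \<le> K"
  shows "AE y in M. cmod (symbol f y) \<le> K"
proof -
  have "AE y in M. cmod (act f w y) \<le> K * cmod (w y)"
    by (rule act_pointwise_le[OF assms(1) w_Lp assms(2)]) (rule assms(3))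
  then show ?thesis
    by eventually_elim (simp add: act_w norm_mult w_nonzero)
qed

lemma symbol_add:
  assumes "cont f" "cont g"
  shows "AE y in M. symbol (\<lambda>x. f x + g x) y = symbol f y + symbol g y"
  using act_fun_add[OF assms w_Lp] by eventually_elim (simp add: symbol_def add_divide_distrib)

lemma symbol_cmult:
  assumes "cont f"
  shows "AE y in M. symbol (\<lambda>x. c * f x) y = c * symbol f y"
  using act_fun_cmult[OF assms w_Lp, of c] by eventually_elim (simp add: symbol_def)

lemma symbol_one: "AE y in M. symbol (\<lambda>x. 1) y = 1"
  using act_one[OF w_Lp] by eventually_elim (simp add: symbol_def w_nonzero)

text \<open>
  Here \<open>\<pi>(g)w\<close> is a vector other than \<open>w\<close>, so it matters that \<open>\<pi>(f)\<close> multiplies every vector by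
  the same function.
\<close>
lemma symbol_mult:
  assumes "cont f" "cont g"
  shows "AE y in M. symbol (\<lambda>x. f x * g x) y = symbol f y * symbol g y"
  using act_fun_mult[OF assms w_Lp] act_eq_symbol_mult[OF assms(1) act_Lp[OF assms(2) w_Lp]]
  by eventually_elim (simp add: act_w w_nonzero)

text \<open>
  With \<open>h = symbol g\<close>, the pointwise bound for \<open>g + i c\<close> gives \<open>|h + i c|\<^sup>2 \<le> K\<^sup>2 + c\<^sup>2\<close>, hence
  \<open>2 c Im h \<le> K\<^sup>2\<close>.  This holds off a single null set for all integers \<open>c\<close>, of either sign.
\<close>
lemma symbol_real:
  fixes g :: "'x \<Rightarrow> real"
  assumes g: "continuous_map X euclideanreal g"
  shows "AE y in M. Im (symbol (\<lambda>x. of_real (g x)) y) = 0"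
proof -
  let ?f = "\<lambda>x. complex_of_real (g x)"
  note f = continuous_map_complex_of_real[OF g]
  obtain K where K: "0 \<le> K" "\<And>x. x \<in> topspace X \<Longrightarrow> \<bar>g x\<bar> \<le> K"
    using cont_bounded[OF f] by (metis norm_of_real real_norm_def)
  have "AE y in M. (Im (symbol ?f y) + of_int c)\<^sup>2 \<le> K\<^sup>2 + (of_int c)\<^sup>2" for c :: int
  proof -
    \<comment> \<open>The factor \<open>1\<close> exhibits the constant as a multiple of the unit of \<open>C(X)\<close>.\<close>
    let ?c = "\<lambda>x::'x. \<i> * of_int c * 1"
    have "AE y in M. cmod (symbol (\<lambda>x. ?f x + ?c x) y) \<le> sqrt (K\<^sup>2 + (of_int c)\<^sup>2)"
    proof (rule symbol_le)
      show "cont (\<lambda>x. ?f x + ?c x)"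
        by (intro continuous_map_add f) auto
      fix x assume "x \<in> topspace X"
      then have "(g x)\<^sup>2 \<le> K\<^sup>2"
        using K(2)[of x] K(1) by (simp add: abs_le_square_iff[symmetric])
      then show "cmod (?f x + ?c x) \<le> sqrt (K\<^sup>2 + (of_int c)\<^sup>2)"
        by (simp add: cmod_def)
    qed simp
    moreover have "AE y in M. symbol (\<lambda>x. ?f x + ?c x) y = symbol ?f y + symbol ?c y"
      by (rule symbol_add[OF f]) simp
    moreover have "AE y in M. symbol ?c y = \<i> * of_int c * symbol (\<lambda>x. 1) y"
      by (rule symbol_cmult) simp
    ultimately show ?thesis
      using symbol_one
    proof eventually_elim
      case (elim y)
      then have "(Re (symbol ?f y))\<^sup>2 + (Im (symbol ?f y) + of_int c)\<^sup>2 \<le> K\<^sup>2 + (of_int c)\<^sup>2"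
        by (simp add: cmod_def)
      then show ?case using zero_le_power2[of "Re (symbol ?f y)"] by linarith
    qed
  qed
  then have "AE y in M. \<forall>c::int. (Im (symbol ?f y) + of_int c)\<^sup>2 \<le> K\<^sup>2 + (of_int c)\<^sup>2"
    by (simp add: AE_all_countable)
  then show ?thesis
  proof eventually_elim
    case (elim y)
    let ?h = "Im (symbol ?f y)"
    have le: "2 * of_int c * ?h \<le> K\<^sup>2" for c :: int
    proof -
      have "?h\<^sup>2 + 2 * of_int c * ?h + (of_int c)\<^sup>2 \<le> K\<^sup>2 + (of_int c)\<^sup>2"
        using elim[rule_format, of c] by (simp add: power2_sum algebra_simps)
      then show ?thesis using zero_le_power2[of ?h] by linarith
    qed
    show "?h = 0"
    proof (rule ccontr)
      assume "?h \<noteq> 0"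
      then obtain n where n: "K\<^sup>2 < of_nat n * \<bar>?h\<bar>"
        using reals_Archimedean3[of "\<bar>?h\<bar>"] by auto
      have "2 * real n * \<bar>?h\<bar> \<le> K\<^sup>2"
        using le[of "int n"] le[of "- int n"] by (auto simp: abs_if)
      then show False using n zero_le_power2[of K] by auto
    qed
  qed
qed

lemma symbol_cnj:
  assumes f: "cont f"
  shows "AE y in M. symbol (\<lambda>x. cnj (f x)) y = cnj (symbol f y)"
proof -
  let ?a = "\<lambda>x. complex_of_real (Re (f x))" and ?b = "\<lambda>x. complex_of_real (Im (f x))"
  note ab = continuous_map_complex_of_real[OF continuous_map_Re_Im(1)[OF f]] continuous_map_complex_of_real[OF continuous_map_Re_Im(2)[OF f]]
  have mult: "cont (\<lambda>x. c * ?b x)" for c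
    by (intro continuous_map_complex_mult ab) auto
  have parts: "f = (\<lambda>x. ?a x + \<i> * ?b x)" "(\<lambda>x. cnj (f x)) = (\<lambda>x. ?a x + (- \<i>) * ?b x)"
    by (auto simp: fun_eq_iff complex_eq_iff)
  have "AE y in M. symbol f y = symbol ?a y + symbol (\<lambda>x. \<i> * ?b x) y"
    using symbol_add[OF ab(1) mult[of \<i>]] parts(1) by simp
  moreover have "AE y in M. symbol (\<lambda>x. cnj (f x)) y = symbol ?a y + symbol (\<lambda>x. (- \<i>) * ?b x) y"
    unfolding parts(2) by (rule symbol_add[OF ab(1) mult])
  ultimately show ?thesis
    using symbol_cmult[OF ab(2), of \<i>] symbol_cmult[OF ab(2), of "-\<i>"]
      symbol_real[OF continuous_map_Re_Im(1)[OF f]] symbol_real[OF continuous_map_Re_Im(2)[OF f]]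
    by eventually_elim (simp add: complex_eq_iff)
qed

end

section \<open>The homomorphism into the essentially bounded functions\<close>

lemma Linfty_simps:
  "carrier (Linfty_algebra M) = ae_class M ` {f \<in> borel_measurable M. \<exists>K. AE y in M. cmod (f y) \<le> K}"
  "one (Linfty_algebra M) = ae_class M (\<lambda>y. 1)"
  by (simp_all add: Linfty_algebra_def)

lemma Linfty_ae_class:
  assumes "f \<in> borel_measurable M"
  shows "ae_class M (\<lambda>y. c * f y) = c \<odot>\<^bsub>Linfty_algebra M\<^esub> ae_class M f"
    and "ae_class M (\<lambda>y. cnj (f y)) = star (Linfty_algebra M) (ae_class M f)"
  unfolding Linfty_algebra_def
  by (simp_all, (rule ae_class_eqI, use rep_ae_class(2)[OF assms] in \<open>eventually_elim, simp\<close>)+)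

lemma Linfty_ae_class2:
  assumes "f \<in> borel_measurable M" "g \<in> borel_measurable M"
  shows "ae_class M (\<lambda>y. f y + g y) = ae_class M f \<oplus>\<^bsub>Linfty_algebra M\<^esub> ae_class M g"
    and "ae_class M (\<lambda>y. f y * g y) = ae_class M f \<otimes>\<^bsub>Linfty_algebra M\<^esub> ae_class M g"
  unfolding Linfty_algebra_def
  by (simp_all, (rule ae_class_eqI,
      use rep_ae_class(2)[OF assms(1)] rep_ae_class(2)[OF assms(2)] in \<open>eventually_elim, simp\<close>)+)

context contractive_rep_on_Lp
begin

lemma carrier_C_cont: "f \<in> carrier (C_algebra X) \<Longrightarrow> cont f"
  by (simp add: C_algebra_def)

lemma restrict_carrier_C: "f \<in> carrier (C_algebra X) \<Longrightarrow> restrict f (topspace X) = f"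
  by (simp add: C_algebra_def extensional_restrict)

lemma symbol_restrict: "symbol (restrict f (topspace X)) = symbol f"
  by (simp add: symbol_def act_def fun_eq_iff)

lemma unital_star_hom_symbol:
  "unital_star_hom (C_algebra X) (Linfty_algebra M) (\<lambda>f. ae_class M (symbol f))"
proof -
  let ?\<phi> = "\<lambda>f. ae_class M (symbol f)"
  note meas = symbol_measurable[OF carrier_C_cont]
  have carrier: "?\<phi> f \<in> carrier (Linfty_algebra M)" if "f \<in> carrier (C_algebra X)" for f
  proof -
    note f = carrier_C_cont[OF that]
    obtain K where "0 \<le> K" "\<And>x. x \<in> topspace X \<Longrightarrow> cmod (f x) \<le> K"
      using cont_bounded[OF f] by blast
    then have "AE y in M. cmod (symbol f y) \<le> K"
      by (rule symbol_le[OF f])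
    then show ?thesis using meas[OF that] by (auto simp: Linfty_simps)
  qed
  have add: "?\<phi> (f \<oplus>\<^bsub>C_algebra X\<^esub> g) = ?\<phi> f \<oplus>\<^bsub>Linfty_algebra M\<^esub> ?\<phi> g"
    and mult: "?\<phi> (f \<otimes>\<^bsub>C_algebra X\<^esub> g) = ?\<phi> f \<otimes>\<^bsub>Linfty_algebra M\<^esub> ?\<phi> g"
    if "f \<in> carrier (C_algebra X)" "g \<in> carrier (C_algebra X)" for f g
    using ae_class_eqI[OF symbol_add[OF that[THEN carrier_C_cont]]]
      ae_class_eqI[OF symbol_mult[OF that[THEN carrier_C_cont]]]
    by (simp_all add: C_algebra_def symbol_restrict Linfty_ae_class2[OF meas meas, OF that])
  have one: "?\<phi> \<one>\<^bsub>C_algebra X\<^esub> = \<one>\<^bsub>Linfty_algebra M\<^esub>"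
    using ae_class_eqI[OF symbol_one] by (simp add: C_algebra_def symbol_restrict Linfty_simps)
  have smult: "?\<phi> (c \<odot>\<^bsub>C_algebra X\<^esub> f) = c \<odot>\<^bsub>Linfty_algebra M\<^esub> ?\<phi> f"
    and star: "?\<phi> (star (C_algebra X) f) = star (Linfty_algebra M) (?\<phi> f)"
    if "f \<in> carrier (C_algebra X)" for c f
    using ae_class_eqI[OF symbol_cmult[OF carrier_C_cont[OF that]]]
      ae_class_eqI[OF symbol_cnj[OF carrier_C_cont[OF that]]]
    by (simp_all add: C_algebra_def symbol_restrict Linfty_ae_class[OF meas[OF that]])
  show ?thesis
    unfolding unital_star_hom_def unital_algebra_hom_def ring_hom_def
    using carrier add mult one smult star by auto
qed

lemma \<pi>_eq_mult_rep:
  assumes "f \<in> carrier (C_algebra X)"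
  shows "\<pi> f = mult_rep p M (ae_class M (symbol f))"
proof (rule extensionalityI)
  note f = carrier_C_cont[OF assms]
  show "\<pi> f \<in> extensional (carrier (Lp_space p M))"
    using operator_\<pi>[OF f] by (simp add: restrict_carrier_C[OF assms] bounded_operators_def PiE_def)
  show "mult_rep p M (ae_class M (symbol f)) \<in> extensional (carrier (Lp_space p M))"
    by (simp add: mult_rep_def)
  fix F assume F: "F \<in> carrier (Lp_space p M)"
  note rep = ae_class_rep[OF F p_pos(2)]
  have "\<pi> f F = ae_class M (act f (rep F))"
    using ae_class_act[OF f rep(1)] by (simp add: restrict_carrier_C[OF assms] rep(2))
  also have "\<dots> = ae_class M (\<lambda>y. rep (ae_class M (symbol f)) y * rep F y)"
    by (rule ae_class_eqI)
      (use act_eq_symbol_mult[OF f rep(1)] rep_ae_class(2)[OF symbol_measurable[OF f]] in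
        \<open>eventually_elim, simp\<close>)
  finally show "\<pi> f F = mult_rep p M (ae_class M (symbol f)) F"
    using F by (simp add: mult_rep_def)
qed

end

lemma nowhere_zero_Lp_function:
  assumes "sigma_finite_measure M" "0 < p"
  obtains w where "w \<in> Lp_functions p M" "\<And>y. w y \<noteq> 0"
proof -
  interpret sigma_finite_measure M by (rule assms(1))
  obtain h :: "'a \<Rightarrow> real" where h: "h \<in> borel_measurable M" "\<And>y. 0 < h y" "integrable M h"
    using obtain_positive_integrable_function by metis
  show thesis
  proof
    show "(\<lambda>y. complex_of_real (h y powr (1 / p))) \<in> Lp_functions p M"
      using h assms(2) by (auto simp: Lp_functions_def powr_powr less_imp_le)
    show "complex_of_real (h y powr (1 / p)) \<noteq> 0" for y
      using h(2)[of y] by simp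
  qed
qed

theorem theorem4p5:
  fixes p :: real
    and X :: "'x topology"
    and M :: "'y measure"
    and \<pi> :: "('x \<Rightarrow> complex) \<Rightarrow> (('y \<Rightarrow> complex) set \<Rightarrow> ('y \<Rightarrow> complex) set)"
  assumes "1 \<le> p" and "p \<noteq> 2"
    and "compact_space X" and "metrizable_space X"
    and "sigma_finite_measure M"
    and "unital_algebra_hom (C_algebra X) (bounded_operators (Lp_space p M)) \<pi>"
    and "contractive (C_algebra X) (bounded_operators (Lp_space p M)) \<pi>"
  shows "\<exists>\<phi>. unital_star_hom (C_algebra X) (Linfty_algebra M) \<phi> \<and>
           (\<forall>f\<in>carrier (C_algebra X). \<pi> f = mult_rep p M (\<phi> f))"
proof -
  obtain w where "w \<in> Lp_functions p M" "\<And>y. w y \<noteq> 0"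
    using nowhere_zero_Lp_function[of M p] assms by auto
  then interpret contractive_rep_on_Lp p X M \<pi> w
    using assms by unfold_locales
  show ?thesis
    using unital_star_hom_symbol \<pi>_eq_mult_rep by blast
qed

end
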